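(* Let $a\in C^1([-1,1])$ with $a>0$ on $(-1,1)$ and $a(-1)=a(1)=0$, and let $\xi_a(x)=\int_0^x\frac{ds}{a(s)}$. If $\xi_a\in L^p(-1,1)$ for some $p\ge1$, then $$H^1_a(-1,1)\hookrightarrow L^{2p}(-1,1).$$ Moreover, there is a positive constant $c$ such that for all $u\in H^1_a(-1,1)$ $$\|u\|_{L^{2p}(-1,1)}\le c\,\|u\|_{1,a}.$$
   Context: $H^1_a(-1,1)=\{u\in L^2(-1,1): u$ is locally absolutely continuous in $(-1,1)$ and $\sqrt a\,u_x\in L^2(-1,1)\}$, with norm $\|u\|_{1,a}^2=\|u\|_{L^2(-1,1)}^2+\|\sqrt a\,u_x\|_{L^2(-1,1)}^2$. *)

theory Defs
  imports "HOL-Analysis.Analysis"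
begin

text \<open>
  All functions are total functions \<open>real \<Rightarrow> real\<close> of which only the values on the relevant set
  matter.  Elements of \<open>L\<^sup>p\<close> are represented by functions, not by classes modulo equality almost
  everywhere; an element of the weighted Sobolev space is represented by its locally absolutely
  continuous representative.
\<close>

text \<open>Continuous differentiability up to the boundary; derivatives at boundary points of
  \<open>S\<close> are relative to \<open>S\<close>, i.e. one-sided if \<open>S\<close> is a compact interval.  (The library's
  \<open>C1_differentiable_on\<close> demands two-sided derivatives at every point of the set.)\<close>

definition C1_on :: "real set \<Rightarrow> (real \<Rightarrow> real) \<Rightarrow> bool" where
  "C1_on S f \<longleftrightarrow>
     (\<exists>f'. (\<forall>x\<in>S. (f has_real_derivative f' x) (at x within S)) \<and> continuous_on S f')"

definition Lp_space :: "real \<Rightarrow> real set \<Rightarrow> (real \<Rightarrow> real) set" where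
  "Lp_space p S =
     {f. f \<in> borel_measurable (lebesgue_on S) \<and> integrable (lebesgue_on S) (\<lambda>x. \<bar>f x\<bar> powr p)}"

text \<open>Meaningful only for members of \<open>Lp_space p S\<close>: the Bochner integral of a
  non-integrable function is \<open>0\<close>.\<close>

definition Lp_norm :: "real \<Rightarrow> real set \<Rightarrow> (real \<Rightarrow> real) \<Rightarrow> real" where
  "Lp_norm p S f = (\<integral>x. \<bar>f x\<bar> powr p \<partial>lebesgue_on S) powr (1 / p)"

definition abs_continuous_on :: "real \<Rightarrow> real \<Rightarrow> (real \<Rightarrow> real) \<Rightarrow> bool" where
  "abs_continuous_on \<alpha> \<beta> f \<longleftrightarrow>
     (\<forall>\<epsilon>>0. \<exists>\<delta>>0. \<forall>(n::nat) x y.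
        (\<forall>i<n. \<alpha> \<le> x i \<and> x i \<le> y i \<and> y i \<le> \<beta>) \<and>
        disjoint_family_on (\<lambda>i. {x i<..<y i}) {..<n} \<and>
        (\<Sum>i<n. y i - x i) < \<delta> \<longrightarrow>
        (\<Sum>i<n. \<bar>f (y i) - f (x i)\<bar>) < \<epsilon>)"

text \<open>Absolute continuity on every compact subinterval of the open interval \<open>]l, r[\<close>.\<close>

definition locally_abs_continuous :: "real \<Rightarrow> real \<Rightarrow> (real \<Rightarrow> real) \<Rightarrow> bool" where
  "locally_abs_continuous l r f \<longleftrightarrow>
     (\<forall>\<alpha> \<beta>. l < \<alpha> \<and> \<alpha> \<le> \<beta> \<and> \<beta> < r \<longrightarrow> abs_continuous_on \<alpha> \<beta> f)"

text \<open>For locally absolutely continuous \<open>u\<close>, \<open>deriv u x\<close> is the classical derivative at almost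
  every \<open>x\<close>; its values on the exceptional null set are irrelevant for Lebesgue
  measurability and integrals.\<close>

definition H1a :: "(real \<Rightarrow> real) \<Rightarrow> (real \<Rightarrow> real) set" where
  "H1a a =
     {u \<in> Lp_space 2 {-1<..<1}. locally_abs_continuous (-1) 1 u \<and>
        (\<lambda>x. sqrt (a x) * deriv u x) \<in> Lp_space 2 {-1<..<1}}"

definition H1a_norm :: "(real \<Rightarrow> real) \<Rightarrow> (real \<Rightarrow> real) \<Rightarrow> real" where
  "H1a_norm a u =
     sqrt ((Lp_norm 2 {-1<..<1} u)\<^sup>2 +
           (Lp_norm 2 {-1<..<1} (\<lambda>x. sqrt (a x) * deriv u x))\<^sup>2)"

text \<open>An oriented integral: for \<open>x < 0\<close> it is minus the integral over \<open>]x, 0[\<close>.\<close>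

definition \<xi> :: "(real \<Rightarrow> real) \<Rightarrow> real \<Rightarrow> real" where
  "\<xi> a x = (LBINT s=ereal 0..ereal x. 1 / a s)"

end

theory Submission
  imports Defs
begin

text \<open>
  Cauchy--Schwarz applied to \<open>u y - u x = \<integral> (1 / \<surd>a) \<cdot> (\<surd>a u')\<close> gives
  \<open>\<bar>u x - u 0\<bar>\<^sup>2 \<le> \<parallel>\<surd>a u'\<parallel>\<^sup>2 \<cdot> \<bar>\<xi> x\<bar>\<close>.  Integrating \<open>\<bar>u 0\<bar>\<^sup>2 \<le> 2 \<bar>u x\<bar>\<^sup>2 + 2 \<bar>u x - u 0\<bar>\<^sup>2\<close> over the
  interval bounds \<open>u 0\<close> by the weighted norm, because \<open>\<xi>\<close> is integrable; raising
  \<open>\<bar>u x\<bar>\<^sup>2 \<le> 2 \<bar>u 0\<bar>\<^sup>2 + 2 \<parallel>\<surd>a u'\<parallel>\<^sup>2 \<cdot> \<bar>\<xi> x\<bar>\<close> to the power \<open>p\<close> and integrating gives the claim.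

  The integral formula for absolutely continuous \<open>u\<close> is obtained by writing \<open>u\<close> as a difference
  of two monotone absolutely continuous functions (the positive variation \<open>P\<close> and \<open>P - u\<close>), taking
  Radon--Nikodym densities of their Stieltjes measures, and applying the Lebesgue differentiation
  theorem to these densities.
\<close>

subsection \<open>Positive variation of an absolutely continuous function\<close>


text \<open>Only interiors count: adjacent intervals may share an endpoint, and a pair with equal
  entries is compatible with every other pair.\<close>

definition nonoverlapping :: "real \<times> real \<Rightarrow> real \<times> real \<Rightarrow> bool" where
  "nonoverlapping p q \<longleftrightarrow> {fst p<..<snd p} \<inter> {fst q<..<snd q} = {}"

text \<open>Lists suit induction and concatenation. As the relation is symmetric,
  \<open>sorted_wrt\<close> expresses pairwise disjoint interiors and imposes no order from left to
  right.\<close>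

definition subintervals :: "real \<Rightarrow> real \<Rightarrow> (real \<times> real) list \<Rightarrow> bool" where
  "subintervals \<alpha> \<beta> ps \<longleftrightarrow>
     sorted_wrt nonoverlapping ps \<and> (\<forall>p\<in>set ps. \<alpha> \<le> fst p \<and> fst p \<le> snd p \<and> snd p \<le> \<beta>)"

definition increments :: "(real \<Rightarrow> real) \<Rightarrow> (real \<times> real) list \<Rightarrow> real" where
  "increments f ps = (\<Sum>p\<leftarrow>ps. f (snd p) - f (fst p))"

text \<open>Only signed increments are bounded, so \<open>f\<close> is absolutely continuous iff both \<open>f\<close> and \<open>- f\<close> have
  this property.  The one-sided form is what the positive variation inherits from \<open>f\<close> directly.\<close>

definition upper_ac :: "real \<Rightarrow> real \<Rightarrow> (real \<Rightarrow> real) \<Rightarrow> bool" where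
  "upper_ac \<alpha> \<beta> f \<longleftrightarrow>
     (\<forall>\<epsilon>>0. \<exists>\<delta>>0. \<forall>ps. subintervals \<alpha> \<beta> ps \<and> increments (\<lambda>x. x) ps < \<delta> \<longrightarrow> increments f ps \<le> \<epsilon>)"

lemma increments_simps [simp]:
  "increments f [] = 0"
  "increments f (p # ps) = f (snd p) - f (fst p) + increments f ps"
  "increments f (ps @ qs) = increments f ps + increments f qs"
  by (auto simp: increments_def)

lemma increments_diff: "increments (\<lambda>x. f x - g x) ps = increments f ps - increments g ps"
  by (induction ps) auto

lemma increments_uminus: "increments (\<lambda>x. - f x) ps = - increments f ps"
  by (induction ps) auto

lemma nonoverlapping_sym: "nonoverlapping p q \<Longrightarrow> nonoverlapping q p"
  by (auto simp: nonoverlapping_def)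

lemma nonoverlapping_subset:
  assumes "nonoverlapping p q" "fst p \<le> fst p'" "snd p' \<le> snd p" "fst q \<le> fst q'" "snd q' \<le> snd q"
  shows "nonoverlapping p' q'"
  using assms unfolding nonoverlapping_def by fastforce

text \<open>Induction on the list: the intervals after the first lie in \<open>U\<close> minus the
  first one, and the two measures add up.\<close>

lemma increments_id_le_emeasure:
  assumes "sorted_wrt nonoverlapping ps" "U \<in> sets borel"
    "\<And>p. p \<in> set ps \<Longrightarrow> fst p \<le> snd p \<and> {fst p<..<snd p} \<subseteq> U"
  shows "ennreal (increments (\<lambda>x. x) ps) \<le> emeasure lborel U"
  using assms
proof (induction ps arbitrary: U)
  case Nil
  then show ?case by simp
next
  case (Cons p ps)
  let ?I = "{fst p<..<snd p}"
  have le: "fst p \<le> snd p" "?I \<subseteq> U" using Cons.prems(3)[of p] by auto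
  have IH: "ennreal (increments (\<lambda>x. x) ps) \<le> emeasure lborel (U - ?I)"
  proof (rule Cons.IH)
    show "U - ?I \<in> sets borel" using Cons.prems(2) by auto
    fix q assume q: "q \<in> set ps"
    have "nonoverlapping p q" using Cons.prems(1) q by auto
    then show "fst q \<le> snd q \<and> {fst q<..<snd q} \<subseteq> U - ?I"
      using Cons.prems(3)[of q] q unfolding nonoverlapping_def by auto
  qed (use Cons.prems(1) in auto)
  have "0 \<le> increments (\<lambda>x. x) ps"
    unfolding increments_def using Cons.prems(3) by (intro sum_list_nonneg) auto
  then have "ennreal (increments (\<lambda>x. x) (p # ps)) = ennreal (snd p - fst p) + ennreal (increments (\<lambda>x. x) ps)"
    using le by (simp add: ennreal_plus)
  also have "\<dots> \<le> emeasure lborel ?I + emeasure lborel (U - ?I)"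
    using IH le by (intro add_mono) auto
  also have "\<dots> = emeasure lborel U"
    using le Cons.prems(2) by (subst plus_emeasure) (auto intro!: arg_cong2[where f=emeasure])
  finally show ?case .
qed

lemma increments_id_le:
  assumes "subintervals \<alpha> \<beta> ps" "\<alpha> \<le> \<beta>"
  shows "increments (\<lambda>x. x) ps \<le> \<beta> - \<alpha>"
proof -
  have "ennreal (increments (\<lambda>x. x) ps) \<le> emeasure lborel {\<alpha>..\<beta>}"
    using assms by (intro increments_id_le_emeasure) (fastforce simp: subintervals_def)+
  then show ?thesis using assms by simp
qed

text \<open>Clamping keeps every pair; one lying wholly below \<open>c\<close> collapses to
  \<open>(c, c)\<close>, whose increment is zero.\<close>

definition trunc_below :: "real \<Rightarrow> (real \<times> real) list \<Rightarrow> (real \<times> real) list" where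
  "trunc_below c = map (\<lambda>p. (max c (fst p), max c (snd p)))"

definition trunc_above :: "real \<Rightarrow> (real \<times> real) list \<Rightarrow> (real \<times> real) list" where
  "trunc_above c = map (\<lambda>p. (min c (fst p), min c (snd p)))"

lemma sorted_trunc_below:
  "sorted_wrt nonoverlapping ps \<Longrightarrow> sorted_wrt nonoverlapping (trunc_below c ps)"
  unfolding trunc_below_def sorted_wrt_map
  by (erule sorted_wrt_mono_rel[rotated]) (fastforce simp: nonoverlapping_def)

lemma sorted_trunc_above:
  "sorted_wrt nonoverlapping ps \<Longrightarrow> sorted_wrt nonoverlapping (trunc_above c ps)"
  unfolding trunc_above_def sorted_wrt_map
  by (erule sorted_wrt_mono_rel[rotated]) (fastforce simp: nonoverlapping_def)

lemma subintervals_trunc_below: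
  assumes "subintervals \<alpha> \<beta> ps" "c \<le> \<beta>" shows "subintervals c \<beta> (trunc_below c ps)"
  using assms sorted_trunc_below[of ps c]
  by (fastforce simp: subintervals_def trunc_below_def)

lemma subintervals_trunc_above:
  assumes "subintervals \<alpha> \<beta> ps" "\<alpha> \<le> c" shows "subintervals \<alpha> c (trunc_above c ps)"
  using assms sorted_trunc_above[of ps c]
  by (fastforce simp: subintervals_def trunc_above_def)

text \<open>\<open>min c x\<close> and \<open>max c x\<close> are \<open>c\<close> and
  \<open>x\<close> in some order, so \<open>f c\<close> enters each increment once with either sign
  and cancels.\<close>

lemma increments_trunc:
  "increments f ps = increments f (trunc_above c ps) + increments f (trunc_below c ps)"
  by (induction ps) (auto simp: trunc_above_def trunc_below_def min_def max_def)

section \<open>One-sided bounds for absolutely continuous functions\<close>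

lemma abs_continuous_on_imp_upper_ac:
  assumes "abs_continuous_on \<alpha> \<beta> f" shows "upper_ac \<alpha> \<beta> f"
  unfolding upper_ac_def
proof (intro allI impI)
  fix \<epsilon> :: real assume "\<epsilon> > 0"
  then obtain \<delta> where \<delta>: "\<delta> > 0" and
    ac: "\<And>(n::nat) x y. (\<forall>i<n. \<alpha> \<le> x i \<and> x i \<le> y i \<and> y i \<le> \<beta>) \<Longrightarrow>
        disjoint_family_on (\<lambda>i. {x i<..<y i}) {..<n} \<Longrightarrow>
        (\<Sum>i<n. y i - x i) < \<delta> \<Longrightarrow> (\<Sum>i<n. \<bar>f (y i) - f (x i)\<bar>) < \<epsilon>"
    using assms unfolding abs_continuous_on_def by meson
  have inc: "increments g ps = (\<Sum>i<length ps. g (snd (ps ! i)) - g (fst (ps ! i)))" for g ps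
    unfolding increments_def by (simp add: sum_list_sum_nth atLeast0LessThan)
  have "increments f ps \<le> \<epsilon>" if ps: "subintervals \<alpha> \<beta> ps" "increments (\<lambda>x. x) ps < \<delta>" for ps
  proof -
    have "nonoverlapping (ps ! i) (ps ! j)" if "i < length ps" "j < length ps" "i \<noteq> j" for i j
      using ps(1) that unfolding subintervals_def sorted_wrt_iff_nth_less
      by (metis nat_neq_iff nonoverlapping_sym)
    then have "disjoint_family_on (\<lambda>i. {fst (ps ! i)<..<snd (ps ! i)}) {..<length ps}"
      unfolding disjoint_family_on_def nonoverlapping_def by auto
    then have "(\<Sum>i<length ps. \<bar>f (snd (ps ! i)) - f (fst (ps ! i))\<bar>) < \<epsilon>"
      using ps by (intro ac) (auto simp: subintervals_def inc)
    moreover have "increments f ps \<le> (\<Sum>i<length ps. \<bar>f (snd (ps ! i)) - f (fst (ps ! i))\<bar>)"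
      unfolding inc by (intro sum_mono) auto
    ultimately show ?thesis by linarith
  qed
  then show "\<exists>\<delta>>0. \<forall>ps. subintervals \<alpha> \<beta> ps \<and> increments (\<lambda>x. x) ps < \<delta> \<longrightarrow> increments f ps \<le> \<epsilon>"
    using \<delta> by blast
qed

lemma abs_continuous_on_uminus:
  "abs_continuous_on \<alpha> \<beta> f \<Longrightarrow> abs_continuous_on \<alpha> \<beta> (\<lambda>x. - f x)"
  unfolding abs_continuous_on_def by (simp add: abs_minus_commute)

lemma upper_ac_diff:
  assumes "upper_ac \<alpha> \<beta> f" "upper_ac \<alpha> \<beta> (\<lambda>x. - g x)"
  shows "upper_ac \<alpha> \<beta> (\<lambda>x. f x - g x)"
  unfolding upper_ac_def
proof (intro allI impI)
  fix \<epsilon> :: real assume "\<epsilon> > 0"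
  then have "\<epsilon> / 2 > 0" by simp
  then obtain d e where "d > 0" "e > 0" and
    d: "\<And>ps. subintervals \<alpha> \<beta> ps \<Longrightarrow> increments (\<lambda>x. x) ps < d \<Longrightarrow> increments f ps \<le> \<epsilon> / 2" and
    e: "\<And>ps. subintervals \<alpha> \<beta> ps \<Longrightarrow> increments (\<lambda>x. x) ps < e \<Longrightarrow> increments (\<lambda>x. - g x) ps \<le> \<epsilon> / 2"
    using assms unfolding upper_ac_def by metis
  show "\<exists>\<delta>>0. \<forall>ps. subintervals \<alpha> \<beta> ps \<and> increments (\<lambda>x. x) ps < \<delta>
    \<longrightarrow> increments (\<lambda>x. f x - g x) ps \<le> \<epsilon>"
  proof (intro exI[of _ "min d e"] conjI allI impI)
    fix ps assume "subintervals \<alpha> \<beta> ps \<and> increments (\<lambda>x. x) ps < min d e"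
    then show "increments (\<lambda>x. f x - g x) ps \<le> \<epsilon>"
      using d[of ps] e[of ps] by (simp add: increments_diff increments_uminus)
  qed (use \<open>d > 0\<close> \<open>e > 0\<close> in auto)
qed

text \<open>Cut the interval into pieces of length at most \<open>\<delta> / 2\<close>. A family
  inside one piece has total length below \<open>\<delta>\<close>, hence increment at most 1, and
  the number of pieces is bounded uniformly in \<open>c\<close>.\<close>

lemma upper_ac_bounded:
  assumes "upper_ac \<alpha> \<beta> f"
  obtains M where "\<And>c ps. \<alpha> \<le> c \<Longrightarrow> c \<le> \<beta> \<Longrightarrow> subintervals \<alpha> c ps \<Longrightarrow> increments f ps \<le> M"
proof -
  obtain \<delta> where "\<delta> > 0" and
    \<delta>: "\<And>ps. subintervals \<alpha> \<beta> ps \<Longrightarrow> increments (\<lambda>x. x) ps < \<delta> \<Longrightarrow> increments f ps \<le> 1"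
    using assms unfolding upper_ac_def by (meson zero_less_one)
  have bound: "increments f ps \<le> real n + 1"
    if "\<alpha> \<le> c" "c \<le> \<beta>" "c \<le> \<alpha> + real n * (\<delta> / 2)" "subintervals \<alpha> c ps" for n c ps
    using that
  proof (induction n arbitrary: c ps)
    case 0
    have "subintervals \<alpha> \<beta> ps" using 0 by (fastforce simp: subintervals_def)
    moreover have "increments (\<lambda>x. x) ps \<le> c - \<alpha>" using 0 by (intro increments_id_le) auto
    ultimately show ?case using \<delta>[of ps] 0 \<open>\<delta> > 0\<close> by simp
  next
    case (Suc n)
    \<comment> \<open>\<open>d\<close> splits off the last piece; the maximum covers the case in
      which that piece is the whole interval.\<close>
    define d where "d = max \<alpha> (c - \<delta> / 2)"
    have d: "\<alpha> \<le> d" "d \<le> c" "c - d \<le> \<delta> / 2" "d \<le> \<alpha> + real n * (\<delta> / 2)"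
      using Suc.prems \<open>\<delta> > 0\<close> by (auto simp: d_def max_def field_simps)
    have l: "increments f (trunc_above d ps) \<le> real n + 1"
      using d Suc.prems by (intro Suc.IH[of d] subintervals_trunc_above[of _ c]) auto
    have r: "subintervals d c (trunc_below d ps)"
      using d Suc.prems by (intro subintervals_trunc_below[of \<alpha>]) auto
    then have "subintervals \<alpha> \<beta> (trunc_below d ps)"
      using d Suc.prems by (fastforce simp: subintervals_def)
    moreover have "increments (\<lambda>x. x) (trunc_below d ps) \<le> c - d"
      using r d by (intro increments_id_le) auto
    ultimately have "increments f (trunc_below d ps) \<le> 1"
      using d \<open>\<delta> > 0\<close> by (intro \<delta>) auto
    with l show ?case by (subst increments_trunc[of _ _ d]) simp
  qed
  obtain n where n: "(\<beta> - \<alpha>) / (\<delta> / 2) \<le> real n" using real_arch_simple by blast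
  show ?thesis
  proof
    fix c ps assume c: "\<alpha> \<le> c" "c \<le> \<beta>" "subintervals \<alpha> c ps"
    have "\<beta> - \<alpha> \<le> real n * (\<delta> / 2)" using n \<open>\<delta> > 0\<close> by (simp add: pos_divide_le_eq)
    then show "increments f ps \<le> real n + 1" using c by (intro bound[of c]) auto
  qed
qed

text \<open>The families may leave gaps, so intervals on which \<open>f\<close> decreases can be
  skipped; this is why signed increments yield the positive variation.\<close>

definition pos_variation :: "(real \<Rightarrow> real) \<Rightarrow> real \<Rightarrow> real \<Rightarrow> real" where
  "pos_variation f \<alpha> x = Sup (increments f ` {ps. subintervals \<alpha> x ps})"

lemma increments_le_pos_variation:
  assumes "upper_ac \<alpha> \<beta> f" "\<alpha> \<le> x" "x \<le> \<beta>" "subintervals \<alpha> x ps"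
  shows "increments f ps \<le> pos_variation f \<alpha> x"
proof -
  obtain M where "\<And>c ps. \<alpha> \<le> c \<Longrightarrow> c \<le> \<beta> \<Longrightarrow> subintervals \<alpha> c ps \<Longrightarrow> increments f ps \<le> M"
    using upper_ac_bounded[OF assms(1)] by blast
  then show ?thesis
    unfolding pos_variation_def using assms by (intro cSup_upper) (auto simp: bdd_above_def)
qed

lemma pos_variation_le:
  assumes "\<And>ps. subintervals \<alpha> x ps \<Longrightarrow> increments f ps \<le> b"
  shows "pos_variation f \<alpha> x \<le> b"
proof -
  have "[] \<in> {ps. subintervals \<alpha> x ps}" by (simp add: subintervals_def)
  then show ?thesis
    unfolding pos_variation_def using assms by (intro cSup_least) auto
qed

lemma pos_variation_mono:
  assumes "upper_ac \<alpha> \<beta> f" "\<alpha> \<le> x" "x \<le> y" "y \<le> \<beta>"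
  shows "pos_variation f \<alpha> x \<le> pos_variation f \<alpha> y"
  using assms
  by (intro pos_variation_le increments_le_pos_variation) (auto simp: subintervals_def)

text \<open>Append \<open>(x, y)\<close> to a family on \<open>[\<alpha>, x]\<close>. Consequently
  the positive variation minus \<open>f\<close> is monotone.\<close>

lemma pos_variation_ge_increment:
  assumes "upper_ac \<alpha> \<beta> f" "\<alpha> \<le> x" "x \<le> y" "y \<le> \<beta>"
  shows "pos_variation f \<alpha> x + (f y - f x) \<le> pos_variation f \<alpha> y"
proof -
  have "increments f ps \<le> pos_variation f \<alpha> y - (f y - f x)" if ps: "subintervals \<alpha> x ps" for ps
  proof -
    have "subintervals \<alpha> y (ps @ [(x, y)])"
      using ps assms by (fastforce simp: subintervals_def sorted_wrt_append nonoverlapping_def)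
    then show ?thesis
      using increments_le_pos_variation[OF assms(1), of y "ps @ [(x, y)]"] assms by simp
  qed
  then have "pos_variation f \<alpha> x \<le> pos_variation f \<alpha> y - (f y - f x)"
    by (rule pos_variation_le)
  then show ?thesis by simp
qed

text \<open>A family on \<open>[\<alpha>, y]\<close>, cut at \<open>x\<close>, splits into one
  counted by the variation up to \<open>x\<close> and one on \<open>[x, y]\<close>, to which
  \<open>b\<close> applies.\<close>

lemma pos_variation_diff_le:
  assumes "upper_ac \<alpha> \<beta> f" "\<alpha> \<le> x" "x \<le> y" "y \<le> \<beta>"
    and b: "\<And>ps. subintervals x y ps \<Longrightarrow> increments f ps \<le> b"
  shows "pos_variation f \<alpha> y - pos_variation f \<alpha> x \<le> b"
proof -
  have "increments f ps \<le> pos_variation f \<alpha> x + b" if ps: "subintervals \<alpha> y ps" for ps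
  proof -
    have "increments f (trunc_above x ps) \<le> pos_variation f \<alpha> x"
      using ps assms by (intro increments_le_pos_variation[OF assms(1)] subintervals_trunc_above[of _ y]) auto
    moreover have "increments f (trunc_below x ps) \<le> b"
      using ps assms by (intro b subintervals_trunc_below[of \<alpha>]) auto
    ultimately show ?thesis by (subst increments_trunc[of _ _ x]) simp
  qed
  then have "pos_variation f \<alpha> y \<le> pos_variation f \<alpha> x + b"
    by (rule pos_variation_le)
  then show ?thesis by simp
qed

text \<open>By induction on the list, the increment of the positive variation over each interval is replaced
  by a supremum over subdivisions of that interval; this avoids choosing near-optimal subdivisions of
  all intervals simultaneously.\<close>

lemma increments_pos_variation_le:
  assumes "upper_ac \<alpha> \<beta> f" "subintervals \<alpha> \<beta> ps"
    and "\<And>qs. subintervals \<alpha> \<beta> qs \<Longrightarrow> (\<forall>q\<in>set qs. \<exists>p\<in>set ps. fst p \<le> fst q \<and> snd q \<le> snd p) \<Longrightarrow>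
           increments (\<lambda>x. x) qs \<le> increments (\<lambda>x. x) ps \<Longrightarrow> increments f qs \<le> b"
  shows "increments (pos_variation f \<alpha>) ps \<le> b"
  using assms(2,3)
proof (induction ps arbitrary: b)
  case Nil
  from Nil(2)[of "[]"] show ?case by (simp add: subintervals_def)
next
  case (Cons p ps)
  have p: "\<alpha> \<le> fst p" "fst p \<le> snd p" "snd p \<le> \<beta>" and ps: "subintervals \<alpha> \<beta> ps"
    and no: "\<And>q. q \<in> set ps \<Longrightarrow> nonoverlapping p q"
    using Cons.prems(1) by (auto simp: subintervals_def)
  have "increments f rs \<le> b - increments (pos_variation f \<alpha>) ps"
    if rs: "subintervals (fst p) (snd p) rs" for rs
  proof -
    \<comment> \<open>The bound in the induction hypothesis absorbs \<open>rs\<close>, which is why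
      \<open>b\<close> is generalised; \<open>rs @ qs\<close> is then admissible for
      \<open>p # ps\<close>.\<close>
    have "increments (pos_variation f \<alpha>) ps \<le> b - increments f rs"
    proof (rule Cons.IH[OF ps])
      fix qs assume qs: "subintervals \<alpha> \<beta> qs"
        "\<forall>q\<in>set qs. \<exists>p\<in>set ps. fst p \<le> fst q \<and> snd q \<le> snd p"
        "increments (\<lambda>x. x) qs \<le> increments (\<lambda>x. x) ps"
      have "increments f (rs @ qs) \<le> b"
      proof (rule Cons.prems(2))
        have "nonoverlapping r q" if r: "r \<in> set rs" and q: "q \<in> set qs" for r q
        proof -
          obtain q' where q': "q' \<in> set ps" "fst q' \<le> fst q" "snd q \<le> snd q'" using qs(2) q by blast
          show ?thesis
            by (rule nonoverlapping_subset[OF no[OF q'(1)]]) (use rs r q' in \<open>auto simp: subintervals_def\<close>)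
        qed
        moreover have "\<alpha> \<le> fst r \<and> fst r \<le> snd r \<and> snd r \<le> \<beta>" if "r \<in> set rs" for r
          using rs p that unfolding subintervals_def by force
        ultimately show "subintervals \<alpha> \<beta> (rs @ qs)"
          using rs qs(1) unfolding subintervals_def by (auto simp: sorted_wrt_append)
        show "\<forall>q\<in>set (rs @ qs). \<exists>p\<in>set (p # ps). fst p \<le> fst q \<and> snd q \<le> snd p"
          using rs qs(2) by (auto simp: subintervals_def)
        show "increments (\<lambda>x. x) (rs @ qs) \<le> increments (\<lambda>x. x) (p # ps)"
          using increments_id_le[OF rs] p qs(3) by simp
      qed
      then show "increments f qs \<le> b - increments f rs" by simp
    qed
    then show ?thesis by simp
  qed
  from pos_variation_diff_le[OF assms(1) p this] show ?case by simp
qed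

text \<open>The \<open>\<delta>\<close> of \<open>f\<close> serves unchanged, because refining a
  family does not increase its total length.\<close>

lemma upper_ac_pos_variation:
  assumes "upper_ac \<alpha> \<beta> f" shows "upper_ac \<alpha> \<beta> (pos_variation f \<alpha>)"
  unfolding upper_ac_def
proof (intro allI impI)
  fix \<epsilon> :: real assume "\<epsilon> > 0"
  then obtain \<delta> where "\<delta> > 0" and
    \<delta>: "\<And>ps. subintervals \<alpha> \<beta> ps \<Longrightarrow> increments (\<lambda>x. x) ps < \<delta> \<Longrightarrow> increments f ps \<le> \<epsilon>"
    using assms unfolding upper_ac_def by meson
  show "\<exists>\<delta>>0. \<forall>ps. subintervals \<alpha> \<beta> ps \<and> increments (\<lambda>x. x) ps < \<delta>
    \<longrightarrow> increments (pos_variation f \<alpha>) ps \<le> \<epsilon>"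
    using \<open>\<delta> > 0\<close> by (intro exI[of _ \<delta>] conjI allI impI increments_pos_variation_le[OF assms] \<delta>) auto
qed


subsection \<open>Radon--Nikodym density of an absolutely continuous function\<close>

text \<open>Families of one interval bound the rise of \<open>G\<close>, and monotonicity excludes a
  fall.\<close>

lemma upper_ac_imp_continuous_on:
  assumes "upper_ac \<alpha> \<beta> G" "mono_on {\<alpha>..\<beta>} G"
  shows "continuous_on {\<alpha>..\<beta>} G"
  unfolding continuous_on_iff
proof (intro ballI allI impI)
  fix x e :: real assume x: "x \<in> {\<alpha>..\<beta>}" and "e > 0"
  then have "e / 2 > 0" by simp
  then obtain \<delta> where "\<delta> > 0" and
    \<delta>: "\<And>ps. subintervals \<alpha> \<beta> ps \<Longrightarrow> increments (\<lambda>x. x) ps < \<delta> \<Longrightarrow> increments G ps \<le> e / 2"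
    using assms(1) unfolding upper_ac_def by meson
  have *: "\<bar>G z - G y\<bar> < e" if "y \<in> {\<alpha>..\<beta>}" "z \<in> {\<alpha>..\<beta>}" "y \<le> z" "z - y < \<delta>" for y z
  proof -
    have "G z - G y \<le> e / 2"
      using \<delta>[of "[(y, z)]"] that by (simp add: subintervals_def)
    moreover have "G y \<le> G z" using that assms(2) by (auto simp: mono_on_def)
    ultimately show ?thesis using \<open>e > 0\<close> by simp
  qed
  show "\<exists>d>0. \<forall>x'\<in>{\<alpha>..\<beta>}. dist x' x < d \<longrightarrow> dist (G x') (G x) < e"
  proof (intro exI[of _ \<delta>] conjI ballI impI)
    fix y assume "y \<in> {\<alpha>..\<beta>}" "dist y x < \<delta>"
    then show "dist (G y) (G x) < e"
      using *[of x y] *[of y x] x by (cases "x \<le> y") (auto simp: dist_real_def abs_minus_commute)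
  qed (fact \<open>\<delta> > 0\<close>)
qed

text \<open>A bounded null set lies in an open set of measure below \<open>\<delta>\<close> and is
  covered, inside that set, by countably many nonoverlapping closed intervals. Finite subfamilies
  have Stieltjes measure at most \<open>\<epsilon>\<close>, and continuity from below extends this
  to the whole cover.\<close>

lemma interval_measure_absolutely_continuous:
  assumes ac: "upper_ac \<alpha> \<beta> G" and "\<alpha> \<le> \<beta>" "mono H" "continuous_on UNIV H"
    and H: "\<And>x. H x = G (max \<alpha> (min \<beta> x))"
  shows "absolutely_continuous lborel (interval_measure H)"
proof -
  let ?\<mu> = "interval_measure H"
  have Icc: "emeasure ?\<mu> {a..b} = H b - H a" if "a \<le> b" for a b
    using assms that by (intro emeasure_interval_measure_Icc) (auto simp: mono_def)
  have bdd: "emeasure ?\<mu> N \<le> ennreal \<epsilon>"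
    if N: "N \<in> null_sets lborel" "N \<subseteq> cbox (- m) m" "m > 0" and "\<epsilon> > 0"
    for N :: "real set" and m \<epsilon> :: real
  proof -
    obtain \<delta> where "\<delta> > 0" and
      \<delta>: "\<And>ps. subintervals \<alpha> \<beta> ps \<Longrightarrow> increments (\<lambda>x. x) ps < \<delta> \<Longrightarrow> increments G ps \<le> \<epsilon>"
      using ac \<open>\<epsilon> > 0\<close> unfolding upper_ac_def by meson
    have "N \<in> sets borel" using N(1) by auto
    then obtain U where U: "open U" "N \<subseteq> U" "emeasure lborel (U - N) < \<delta>"
      using outer_regular_lborel[OF _ \<open>\<delta> > 0\<close>] by blast
    then have eU: "emeasure lborel U < \<delta>"
      using emeasure_Diff_null_set[OF N(1), of U] by auto
    \<comment> \<open>On \<open>U\<close> the gauge is \<open>U\<close> itself, so covering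
      intervals tagged in \<open>N\<close> stay inside \<open>U\<close>; the balls merely complete
      the gauge off \<open>U\<close>.\<close>
    define \<gamma> where "\<gamma> x = (if x \<in> U then U else ball x 1)" for x
    have "gauge \<gamma>" using U(1) by (auto simp: gauge_def \<gamma>_def)
    moreover have "box (- m) m \<noteq> {}" using \<open>m > 0\<close> by simp
    ultimately obtain D where D: "countable D" "N \<subseteq> \<Union>D"
      "\<And>K. K \<in> D \<Longrightarrow> interior K \<noteq> {} \<and> (\<exists>c d. K = cbox c d)"
      "pairwise (\<lambda>A B. interior A \<inter> interior B = {}) D"
      "\<And>K. K \<in> D \<Longrightarrow> \<exists>x \<in> N \<inter> K. K \<subseteq> \<gamma> x"
      using covering_lemma[OF N(2)] by metis
    have KU: "K \<subseteq> U" if "K \<in> D" for K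
      using D(5)[OF that] U(2) by (auto simp: \<gamma>_def split: if_splits)
    have K: "Inf K < Sup K \<and> K = {Inf K..Sup K} \<and> interior K = {Inf K<..<Sup K}" if "K \<in> D" for K
    proof -
      obtain c d where K: "K = {c..d}" using D(3)[OF \<open>K \<in> D\<close>] by auto
      with D(3)[OF that] have "c < d" by auto
      with K show ?thesis by auto
    qed
    have fin: "emeasure ?\<mu> (\<Union>F) \<le> ennreal \<epsilon>" if F: "finite F" "F \<subseteq> D" for F
    proof -
      obtain xs where xs: "set xs = F" "distinct xs" using F(1) finite_distinct_list by blast
      define ps0 where "ps0 = map (\<lambda>K. (Inf K, Sup K)) xs"
      \<comment> \<open>\<open>H\<close> is constant on either side of
        \<open>[\<alpha>, \<beta>]\<close>, so the increments of \<open>G\<close> over the clipped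
        family equal those of \<open>H\<close> over \<open>ps0\<close>.\<close>
      define ps where "ps = trunc_below \<alpha> (trunc_above \<beta> ps0)"
      have "nonoverlapping (Inf A, Sup A) (Inf B, Sup B)" if "A \<in> F" "B \<in> F" "A \<noteq> B" for A B
        using D(4) K[of A] K[of B] that F unfolding pairwise_def nonoverlapping_def by (metis fst_conv snd_conv subsetD)
      then have so: "sorted_wrt nonoverlapping ps0"
        unfolding ps0_def sorted_wrt_map sorted_wrt_iff_nth_less
        using xs by (auto simp: nth_eq_iff_index_eq)
      have lt: "fst p < snd p \<and> {fst p<..<snd p} \<subseteq> U" if p: "p \<in> set ps0" for p
      proof -
        obtain A where A: "p = (Inf A, Sup A)" "A \<in> F" using p xs by (auto simp: ps0_def)
        have "{Inf A<..<Sup A} \<subseteq> A" using K[of A] A F interior_subset[of A] by auto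
        then show ?thesis using K[of A] KU[of A] A F by auto
      qed
      have "ennreal (increments (\<lambda>x. x) ps0) \<le> emeasure lborel U"
        using so U(1) lt by (intro increments_id_le_emeasure) (auto intro: less_imp_le)
      then have "ennreal (increments (\<lambda>x. x) ps0) < ennreal \<delta>"
        using eU by (rule le_less_trans)
      then have "increments (\<lambda>x. x) ps0 < \<delta>"
        by (metis ennreal_leI linorder_not_less)
      moreover have "increments (\<lambda>x. x) ps \<le> increments (\<lambda>x. x) ps0"
        unfolding increments_def ps_def trunc_below_def trunc_above_def map_map o_def
        by (intro sum_list_mono) (auto dest!: lt)
      moreover have "subintervals \<alpha> \<beta> ps"
        unfolding subintervals_def
      proof
        show "sorted_wrt nonoverlapping ps"
          unfolding ps_def by (intro sorted_trunc_below sorted_trunc_above so)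
        show "\<forall>p\<in>set ps. \<alpha> \<le> fst p \<and> fst p \<le> snd p \<and> snd p \<le> \<beta>"
          using \<open>\<alpha> \<le> \<beta>\<close> by (auto simp: ps_def trunc_below_def trunc_above_def dest!: lt)
      qed
      ultimately have le: "increments G ps \<le> \<epsilon>" by (intro \<delta>) auto
      have "increments G ps = (\<Sum>A\<leftarrow>xs. H (Sup A) - H (Inf A))"
        unfolding increments_def ps_def ps0_def trunc_below_def trunc_above_def
        by (simp add: H o_def)
      also have "\<dots> = (\<Sum>A\<in>F. H (Sup A) - H (Inf A))"
        using xs by (simp add: sum_list_distinct_conv_sum_set)
      finally have inc: "increments G ps = (\<Sum>A\<in>F. H (Sup A) - H (Inf A))" .
      have mea: "A \<in> sets borel" if "A \<in> F" for A
        using K[of A] F that by (metis borel_closed closed_atLeastAtMost subsetD)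
      have "emeasure ?\<mu> (\<Union>F) = emeasure ?\<mu> (\<Union>A\<in>F. A)" by simp
      also have "\<dots> \<le> (\<Sum>A\<in>F. emeasure ?\<mu> A)"
        using F mea by (intro emeasure_subadditive_finite) auto
      also have "\<dots> = (\<Sum>A\<in>F. ennreal (H (Sup A) - H (Inf A)))"
        using K F Icc by (intro sum.cong refl) (metis less_imp_le subsetD)
      also have "\<dots> = ennreal (increments G ps)"
        unfolding inc using K F \<open>mono H\<close>
        by (intro sum_ennreal) (auto simp: mono_def less_imp_le)
      also have "\<dots> \<le> ennreal \<epsilon>" using le by (rule ennreal_leI)
      finally show ?thesis .
    qed
    show ?thesis
    \<comment> \<open>\<open>from_nat_into\<close> enumerates nonempty sets only; if there are no
      intervals, \<open>N\<close> is empty.\<close>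
    proof (cases "D = {}")
      case True
      with D(2) show ?thesis by simp
    next
      case False
      define A where "A n = \<Union>(from_nat_into D ` {..n})" for n :: nat
      have sub: "from_nat_into D ` {..n} \<subseteq> D" for n using False from_nat_into by blast
      have mea: "B \<in> sets borel" if "B \<in> D" for B
        using K[OF that] by (metis borel_closed closed_atLeastAtMost)
      have "A n \<in> sets borel" for n
        unfolding A_def by (intro sets.finite_Union) (use mea sub in \<open>auto\<close>)
      then have A: "range A \<subseteq> sets ?\<mu>" by auto
      have "X \<subseteq> (\<Union>n. A n)" if "X \<in> D" for X
      proof -
        obtain k where "X = from_nat_into D k"
          using range_from_nat_into[OF False D(1)] \<open>X \<in> D\<close> by blast
        then have "X \<subseteq> A k" unfolding A_def by blast
        then show ?thesis by blast
      qed
      then have "\<Union>D \<subseteq> (\<Union>n. A n)" by blast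
      then have "emeasure ?\<mu> N \<le> emeasure ?\<mu> (\<Union>n. A n)"
        using D(2) A by (intro emeasure_mono) auto
      moreover have "incseq A" by (fastforce simp: incseq_def A_def)
      then have "emeasure ?\<mu> (\<Union>n. A n) = (SUP n. emeasure ?\<mu> (A n))"
        using A by (intro SUP_emeasure_incseq[symmetric])
      moreover have "\<dots> \<le> ennreal \<epsilon>"
        unfolding A_def using fin sub by (intro SUP_least) auto
      ultimately show ?thesis by simp
    qed
  qed
  show ?thesis
    unfolding absolutely_continuous_def
  proof
    fix N :: "real set" assume N: "N \<in> null_sets lborel"
    \<comment> \<open>Bounded boxes exhaust the line; \<open>Suc n\<close> keeps their radius
      positive.\<close>
    have "N \<inter> cbox (- real (Suc n)) (real (Suc n)) \<in> null_sets ?\<mu>" for n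
    proof -
      let ?N = "N \<inter> cbox (- real (Suc n)) (real (Suc n))"
      have "?N \<in> null_sets lborel" using N by (intro null_set_Int2) auto
      then have le: "emeasure ?\<mu> ?N \<le> ennreal \<epsilon>" if "\<epsilon> > 0" for \<epsilon>
        using bdd[of ?N "real (Suc n)" \<epsilon>] that by auto
      have "emeasure ?\<mu> ?N \<le> 0"
      proof (rule ennreal_le_epsilon)
        fix \<epsilon> :: real assume "0 < \<epsilon>"
        from le[OF this] show "emeasure ?\<mu> ?N \<le> 0 + ennreal \<epsilon>" by simp
      qed
      then show ?thesis using N by (auto simp: null_sets_def)
    qed
    then have "(\<Union>n. N \<inter> cbox (- real (Suc n)) (real (Suc n))) \<in> null_sets ?\<mu>"
      by (intro null_sets_UN) auto
    moreover have "(\<Union>n. N \<inter> cbox (- real (Suc n)) (real (Suc n))) = N"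
    proof -
      have "\<exists>n. x \<in> cbox (- real (Suc n)) (real (Suc n))" for x :: real
      proof -
        obtain n where "\<bar>x\<bar> \<le> real n" using real_arch_simple by blast
        then show ?thesis by (intro exI[of _ n]) auto
      qed
      then show ?thesis by blast
    qed
    ultimately show "N \<in> null_sets ?\<mu>" by simp
  qed
qed


lemma upper_ac_mono_density:
  assumes ac: "upper_ac \<alpha> \<beta> G" and mono: "mono_on {\<alpha>..\<beta>} G" and "\<alpha> \<le> \<beta>"
  obtains g :: "real \<Rightarrow> real" where
    "\<And>x y. g integrable_on {x..y}"
    "\<And>x y. \<alpha> \<le> x \<Longrightarrow> x \<le> y \<Longrightarrow> y \<le> \<beta> \<Longrightarrow> (g has_integral (G y - G x)) {x..y}"
proof -
  \<comment> \<open>Extending \<open>G\<close> by constants gives a Stieltjes measure on the whole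
    line, and hence a density integrable over every interval, as the differentiation theorem below
    demands.\<close>
  define H where "H x = G (max \<alpha> (min \<beta> x))" for x
  have H_mono: "mono H"
    using mono \<open>\<alpha> \<le> \<beta>\<close> by (auto simp: mono_def H_def mono_on_def)
  have H_cont: "continuous_on UNIV H"
    unfolding H_def using \<open>\<alpha> \<le> \<beta>\<close>
    by (intro continuous_on_compose2[OF upper_ac_imp_continuous_on[OF ac mono]] continuous_intros) auto
  let ?\<mu> = "interval_measure H"
  have "absolutely_continuous lborel ?\<mu>"
    using interval_measure_absolutely_continuous[OF ac \<open>\<alpha> \<le> \<beta>\<close> H_mono H_cont] H_def by blast
  then obtain h where h [measurable]: "h \<in> borel_measurable lborel" and dens: "density lborel h = ?\<mu>"
    using sigma_finite_measure.Radon_Nikodym[OF sigma_finite_lborel, of ?\<mu>] by auto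
  define g where "g x = enn2real (h x)" for x
  have int: "(g has_integral (H y - H x)) {x..y}" if "x \<le> y" for x y
  proof -
    have nn: "(\<integral>\<^sup>+z. h z * indicator {x..y} z \<partial>lborel) = ennreal (H y - H x)"
      using emeasure_interval_measure_Icc[of x y H] H_mono H_cont that
      by (simp add: dens[symmetric] emeasure_density mono_def)
    \<comment> \<open>The integral is finite, so \<open>h\<close> is finite almost everywhere on the
      interval and \<open>enn2real\<close> loses nothing there.\<close>
    have "AE z in lborel. h z * indicator {x..y} z \<noteq> \<infinity>"
      by (rule nn_integral_PInf_AE) (auto simp: nn)
    then have "AE z in lborel. ennreal (g z * indicator {x..y} z) = h z * indicator {x..y} z"
      by eventually_elim (auto simp: g_def indicator_def less_top)
    then have "(\<integral>\<^sup>+z. ennreal (g z * indicator {x..y} z) \<partial>lborel) = ennreal (H y - H x)"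
      using nn by (simp cong: nn_integral_cong_AE)
    moreover have [measurable]: "g \<in> borel_measurable borel"
      using h unfolding g_def by measurable
    moreover have "0 \<le> g z" for z by (simp add: g_def)
    ultimately have "((\<lambda>z. g z * indicator {x..y} z) has_integral (H y - H x)) UNIV"
      using monoD[OF H_mono that] by (intro nn_integral_has_integral) auto
    moreover have "(\<lambda>z. g z * indicator {x..y} z) = (\<lambda>z. if z \<in> {x..y} then g z else 0)"
      by (auto simp: indicator_def)
    ultimately show ?thesis using has_integral_restrict_UNIV by metis
  qed
  show ?thesis
  proof
    show "g integrable_on {x..y}" for x y
      using int[of x y] by (cases "x \<le> y") auto
    show "(g has_integral (G y - G x)) {x..y}" if "\<alpha> \<le> x" "x \<le> y" "y \<le> \<beta>" for x y
      using int[OF that(2)] that by (simp add: H_def min_absorb2 max_absorb2)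
  qed
qed

text \<open>In \<open>f = P - (P - f)\<close> both parts are monotone and satisfy the one-sided
  bound, the second through the bound for \<open>- f\<close>; the densities are subtracted.\<close>

lemma abs_continuous_on_density:
  assumes ac: "abs_continuous_on \<alpha> \<beta> f" and "\<alpha> \<le> \<beta>"
  obtains g :: "real \<Rightarrow> real" where
    "\<And>x y. g integrable_on {x..y}"
    "\<And>x y. \<alpha> \<le> x \<Longrightarrow> x \<le> y \<Longrightarrow> y \<le> \<beta> \<Longrightarrow> (g has_integral (f y - f x)) {x..y}"
proof -
  note f = abs_continuous_on_imp_upper_ac[OF ac]
  note nf = abs_continuous_on_imp_upper_ac[OF abs_continuous_on_uminus[OF ac]]
  let ?P = "pos_variation f \<alpha>"
  note P = upper_ac_pos_variation[OF f]
  have "mono_on {\<alpha>..\<beta>} ?P"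
    using pos_variation_mono[OF f] by (auto simp: mono_on_def)
  from upper_ac_mono_density[OF P this \<open>\<alpha> \<le> \<beta>\<close>] obtain g where g: "\<And>x y. g integrable_on {x..y}"
    "\<And>x y. \<alpha> \<le> x \<Longrightarrow> x \<le> y \<Longrightarrow> y \<le> \<beta> \<Longrightarrow> (g has_integral (?P y - ?P x)) {x..y}"
    by blast
  have "mono_on {\<alpha>..\<beta>} (\<lambda>x. ?P x - f x)"
    using pos_variation_ge_increment[OF f] by (fastforce simp: mono_on_def)
  from upper_ac_mono_density[OF upper_ac_diff[OF P nf] this \<open>\<alpha> \<le> \<beta>\<close>]
  obtain h where h: "\<And>x y. h integrable_on {x..y}"
    "\<And>x y. \<alpha> \<le> x \<Longrightarrow> x \<le> y \<Longrightarrow> y \<le> \<beta> \<Longrightarrow> (h has_integral (?P y - f y - (?P x - f x))) {x..y}"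
    by blast
  show ?thesis
  proof
    show "(\<lambda>x. g x - h x) integrable_on {x..y}" for x y
      using g(1) h(1) by (rule integrable_diff)
    show "((\<lambda>x. g x - h x) has_integral (f y - f x)) {x..y}" if "\<alpha> \<le> x" "x \<le> y" "y \<le> \<beta>" for x y
      using has_integral_diff[OF g(2)[OF that] h(2)[OF that]] by simp
  qed
qed


subsection \<open>Almost everywhere differentiability\<close>

text \<open>Lebesgue differentiation over cubes with corner \<open>x\<close>, in dimension one;
  hence only quotients to the right appear.\<close>

lemma indefinite_integral_right_derivative:
  fixes g :: "real \<Rightarrow> real"
  assumes "\<And>x y. g integrable_on {x..y}"
  obtains N where "negligible N"
    "\<And>x e. x \<notin> N \<Longrightarrow> 0 < e \<Longrightarrow>
       \<exists>d>0. \<forall>h. 0 < h \<and> h < d \<longrightarrow> \<bar>integral {x..x + h} g / h - g x\<bar> < e"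
proof -
  have "g integrable_on cbox x y" for x y using assms by simp
  from integrable_ccontinuous_explicit[OF this] obtain N where "negligible N"
    "\<And>x e. x \<notin> N \<Longrightarrow> 0 < e \<Longrightarrow> \<exists>d>0. \<forall>h. 0 < h \<and> h < d \<longrightarrow>
        norm (integral (cbox x (x + h *\<^sub>R One)) g /\<^sub>R h ^ DIM(real) - g x) < e"
    by metis
  then show ?thesis by (intro that[of N]) (simp_all add: divide_inverse mult.commute)
qed

text \<open>Left quotients at \<open>x\<close> are right quotients of the reflected function at
  \<open>- x\<close>, so the exceptional set is one null set united with the reflection of
  another.\<close>

lemma indefinite_integral_has_derivative:
  fixes f g :: "real \<Rightarrow> real"
  assumes g: "\<And>x y. g integrable_on {x..y}"
    and f: "\<And>x y. \<alpha> \<le> x \<Longrightarrow> x \<le> y \<Longrightarrow> y \<le> \<beta> \<Longrightarrow> (g has_integral (f y - f x)) {x..y}"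
  obtains N where "negligible N"
    "\<And>x. \<alpha> < x \<Longrightarrow> x < \<beta> \<Longrightarrow> x \<notin> N \<Longrightarrow> (f has_real_derivative g x) (at x)"
proof -
  obtain N1 where N1: "negligible N1"
    "\<And>x e. x \<notin> N1 \<Longrightarrow> 0 < e \<Longrightarrow>
       \<exists>d>0. \<forall>h. 0 < h \<and> h < d \<longrightarrow> \<bar>integral {x..x + h} g / h - g x\<bar> < e"
    using indefinite_integral_right_derivative[OF g] by blast
  have "(\<lambda>x. g (- x)) integrable_on {x..y}" for x y
    using Henstock_Kurzweil_Integration.integrable_reflect_real[where f = g and a = "- y" and b = "- x"] g[of "- y" "- x"] by simp
  then obtain N2 where N2: "negligible N2"
    "\<And>x e. x \<notin> N2 \<Longrightarrow> 0 < e \<Longrightarrow>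
       \<exists>d>0. \<forall>h. 0 < h \<and> h < d \<longrightarrow> \<bar>integral {x..x + h} (\<lambda>x. g (- x)) / h - g (- x)\<bar> < e"
    using indefinite_integral_right_derivative[of "\<lambda>x. g (- x)"] by blast
  have "negligible (uminus ` N2)"
    using N2(1)
    by (intro negligible_differentiable_image_negligible differentiable_on_minus differentiable_on_ident) auto
  then have "negligible (N1 \<union> uminus ` N2)"
    using N1(1) by (intro negligible_Un)
  moreover have "(f has_real_derivative g x) (at x)"
    if x: "\<alpha> < x" "x < \<beta>" "x \<notin> N1 \<union> uminus ` N2" for x
    unfolding DERIV_def LIM_def
  proof (intro allI impI)
    fix e :: real assume "e > 0"
    have "x \<notin> N1" "- x \<notin> N2" using x(3) by (auto simp: image_iff)
    with N1(2)[of x e] N2(2)[of "- x" e] \<open>e > 0\<close> obtain d1 d2 where d: "d1 > 0" "d2 > 0" and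
      d1: "\<And>h. 0 < h \<Longrightarrow> h < d1 \<Longrightarrow> \<bar>integral {x..x + h} g / h - g x\<bar> < e" and
      d2: "\<And>h. 0 < h \<Longrightarrow> h < d2 \<Longrightarrow> \<bar>integral {- x..- x + h} (\<lambda>x. g (- x)) / h - g x\<bar> < e"
      by auto
    \<comment> \<open>The last two entries keep \<open>x + h\<close> inside
      \<open>[\<alpha>, \<beta>]\<close>, where the increments of \<open>f\<close> are integrals of
      \<open>g\<close>.\<close>
    define d where "d = Min {d1, d2, \<beta> - x, x - \<alpha>}"
    show "\<exists>s>0. \<forall>h. h \<noteq> 0 \<and> dist h 0 < s \<longrightarrow> dist ((f (x + h) - f x) / h) (g x) < e"
    proof (intro exI[of _ d] conjI allI impI)
      show "d > 0" using d x by (simp add: d_def)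
      fix h :: real assume h: "h \<noteq> 0 \<and> dist h 0 < d"
      show "dist ((f (x + h) - f x) / h) (g x) < e"
      proof (cases "h > 0")
        case True
        with h have "h < d1" "x + h \<le> \<beta>" by (auto simp: d_def)
        then show ?thesis
          using d1[of h] True f[of x "x + h"] x by (simp add: integral_unique dist_real_def)
      next
        case False
        with h have k: "- h > 0" "- h < d2" "\<alpha> \<le> x + h" by (auto simp: d_def dist_real_def)
        have "integral {- x..- x + - h} (\<lambda>x. g (- x)) = integral {x + h..x} g"
          using Henstock_Kurzweil_Integration.integral_reflect_real[where f = g and a = "x + h" and b = x] by (simp add: add.commute)
        also have "\<dots> = f x - f (x + h)"
          using f[of "x + h" x] k x by (simp add: integral_unique)
        finally have I: "integral {- x..- x + - h} (\<lambda>x. g (- x)) = f x - f (x + h)" .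
        have "(f (x + h) - f x) / h = integral {- x..- x + - h} (\<lambda>x. g (- x)) / (- h)"
          unfolding I by (simp add: minus_divide_left)
        then show ?thesis using d2[of "- h"] k by (simp add: dist_real_def)
      qed
    qed
  qed
  ultimately show ?thesis using that by blast
qed

text \<open>The density and \<open>deriv f\<close> agree off a negligible set; the endpoints are
  added to it because the derivative is identified only in the interior.\<close>

theorem abs_continuous_on_deriv_has_integral:
  assumes "abs_continuous_on \<alpha> \<beta> f" "\<alpha> \<le> \<beta>"
  shows "(deriv f has_integral (f \<beta> - f \<alpha>)) {\<alpha>..\<beta>}"
proof -
  obtain g where g: "\<And>x y. g integrable_on {x..y}"
    "\<And>x y. \<alpha> \<le> x \<Longrightarrow> x \<le> y \<Longrightarrow> y \<le> \<beta> \<Longrightarrow> (g has_integral (f y - f x)) {x..y}"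
    using abs_continuous_on_density[OF assms] by blast
  obtain N where N: "negligible N"
    "\<And>x. \<alpha> < x \<Longrightarrow> x < \<beta> \<Longrightarrow> x \<notin> N \<Longrightarrow> (f has_real_derivative g x) (at x)"
    using indefinite_integral_has_derivative[OF g] by blast
  have "negligible (N \<union> {\<alpha>, \<beta>})" using N(1) by (simp add: negligible_Un)
  from this show ?thesis
    by (rule has_integral_spike[OF _ _ g(2)]) (use assms N(2) in \<open>auto intro!: DERIV_imp_deriv\<close>)
qed


subsection \<open>The weighted space\<close>

lemma C1_on_imp_continuous_on: 
  assumes "C1_on S f" shows "continuous_on S f"
proof -
  obtain f' where "\<And>x. x \<in> S \<Longrightarrow> (f has_real_derivative f' x) (at x within S)"
    using assms unfolding C1_on_def by blast
  then show ?thesis by (rule DERIV_continuous_on)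
qed

section \<open>Increments of \<open>\<xi>\<close> and of members of the weighted space\<close>

lemma \<xi>_zero [simp]: "\<xi> a 0 = 0"
  unfolding \<xi>_def by simp

lemma has_integral_\<xi>:
  assumes cont: "continuous_on {-1<..<1} a" and pos: "\<And>x. x \<in> {-1<..<1} \<Longrightarrow> a x > 0"
    and xy: "-1 < x" "x \<le> y" "y < 1"
  shows "((\<lambda>s. 1 / a s) has_integral (\<xi> a y - \<xi> a x)) {x..y}"
proof -
  \<comment> \<open>The interval is enlarged to contain 0, the base point of \<open>\<xi>\<close>;
    it remains a compact part of the open interval, so \<open>1 / a\<close> is continuous on
    it.\<close>
  define l r where "l = min x 0" and "r = max y 0"
  have lr: "-1 < l" "l \<le> x" "l \<le> 0" "0 \<le> r" "y \<le> r" "r < 1"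
    using xy by (auto simp: l_def r_def)
  have "a s \<noteq> 0" if "s \<in> {l..r}" for s
    using pos[of s] that lr by auto
  moreover have "continuous_on {l..r} a"
    using lr by (intro continuous_on_subset[OF cont]) auto
  ultimately have c: "continuous_on {l..r} (\<lambda>s. 1 / a s)"
    by (intro continuous_on_divide[OF continuous_on_const]) auto
  have \<xi>: "\<xi> a = (\<lambda>x. LBINT s=ereal 0..ereal x. 1 / a s)"
    by (simp add: \<xi>_def fun_eq_iff)
  have "(\<xi> a has_vector_derivative 1 / a z) (at z within {x..y})" if "z \<in> {x..y}" for z
  proof (rule has_vector_derivative_within_subset)
    show "(\<xi> a has_vector_derivative 1 / a z) (at z within {l..r})"
      unfolding \<xi> by (rule interval_integral_FTC2) (use c lr that in auto)
    show "{x..y} \<subseteq> {l..r}" using lr by auto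
  qed
  then show ?thesis using xy by (intro fundamental_theorem_of_calculus) auto
qed

text \<open>Turns the bound from Young's inequality, optimised over the parameter \<open>t\<close>, into the one from the
  Cauchy--Schwarz inequality.\<close>

lemma weighted_Cauchy_Schwarz:
  fixes A K w :: real
  assumes "A \<ge> 0" "K \<ge> 0" "w \<ge> 0"
    and w: "\<And>t. t > 0 \<Longrightarrow> w \<le> t / 2 * A + K / (2 * t)"
  shows "w\<^sup>2 \<le> K * A"
proof (cases "w = 0")
  case True
  then show ?thesis using assms by simp
next
  case False
  show ?thesis
  proof (cases "A = 0")
    case True
    \<comment> \<open>For \<open>A = 0\<close> the bound \<open>K / (2 * t)\<close> vanishes as
      \<open>t\<close> grows, so \<open>w > 0\<close> is impossible; this \<open>t\<close> already
      gives the absurd \<open>2 * (K + 1) \<le> K\<close>.\<close>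
    define t where "t = (K + 1) / w"
    have "t > 0" using assms False by (auto simp: t_def add_nonneg_pos)
    have "2 * (K + 1) = 2 * t * w" using False by (simp add: t_def)
    also have "\<dots> \<le> K" using w[OF \<open>t > 0\<close>] \<open>t > 0\<close> True by (simp add: field_simps)
    finally show ?thesis using assms by simp
  next
    case A: False
    \<comment> \<open>This choice turns the first term into \<open>w / 2\<close>, which the
      left-hand side absorbs.\<close>
    define t where "t = w / A"
    have t: "t > 0" "t * A = w" using assms A False by (auto simp: t_def)
    have "w \<le> w / 2 + K / (2 * t)" using w[OF \<open>t > 0\<close>] t by simp
    then have "w \<le> K / t" by simp
    then have "w * t \<le> K" using t by (simp add: field_simps)
    then have "w * t * A \<le> K * A" using assms by (intro mult_right_mono) auto
    then show ?thesis using t by (simp add: power2_eq_square mult.assoc)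
  qed
qed

text \<open>Young's inequality bounds the derivative pointwise by a multiple of \<open>1 / a\<close>
  plus a multiple of the energy density \<open>E\<close>. Integrating this and optimising over
  \<open>t\<close> gives the product form.\<close>

lemma H1a_increment_le:
  assumes cont: "continuous_on {-1<..<1} a" and pos: "\<And>x. x \<in> {-1<..<1} \<Longrightarrow> a x > 0"
    and u: "u \<in> H1a a" and xy: "-1 < x" "x \<le> y" "y < 1"
  shows "(u y - u x)\<^sup>2 \<le>
    (\<integral>s. \<bar>sqrt (a s) * deriv u s\<bar> powr 2 \<partial>lebesgue_on {-1<..<1}) * (\<xi> a y - \<xi> a x)"
proof -
  define E where "E s = \<bar>sqrt (a s) * deriv u s\<bar> powr 2" for s
  define K where "K = (\<integral>s. E s \<partial>lebesgue_on {-1<..<1})"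
  define A where "A = \<xi> a y - \<xi> a x"
  have E_int: "integrable (lebesgue_on {-1<..<1}) E"
    using u by (simp add: H1a_def Lp_space_def E_def [abs_def])
  have E_has: "(E has_integral K) {-1<..<1}"
    unfolding K_def using E_int by (rule has_integral_integral_lebesgue_on) simp
  \<comment> \<open>Since \<open>E\<close> is nonnegative, its integrability is absolute and
    therefore passes to subintervals.\<close>
  have "E absolutely_integrable_on {-1<..<1}"
    using E_has by (intro nonnegative_absolutely_integrable_1) (auto simp: E_def)
  then have "E absolutely_integrable_on {x..y}"
    by (rule set_integrable_subset) (use xy in auto)
  then have E_xy: "E integrable_on {x..y}"
    using absolutely_integrable_on_def by blast
  have E_le: "integral {x..y} E \<le> K"
    using E_has E_xy xy
    by (subst integral_unique[OF E_has, symmetric]) (intro integral_subset_le, auto simp: E_def)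
  have "abs_continuous_on x y u"
    using u xy by (auto simp: H1a_def locally_abs_continuous_def)
  then have D: "(deriv u has_integral (u y - u x)) {x..y}"
    using xy(2) by (rule abs_continuous_on_deriv_has_integral)
  have W: "((\<lambda>s. 1 / a s) has_integral A) {x..y}"
    unfolding A_def using has_integral_\<xi>[OF cont pos xy] by simp
  have a: "a s > 0" if "s \<in> {x..y}" for s using pos[of s] that xy by auto
  have "A \<ge> 0" using W by (rule has_integral_nonneg) (use a in \<open>auto intro: less_imp_le\<close>)
  have "K \<ge> 0" unfolding K_def by (intro integral_nonneg_AE) (auto simp: E_def)
  have "\<bar>u y - u x\<bar> \<le> t / 2 * A + K / (2 * t)" if "t > 0" for t
  proof -
    have R: "((\<lambda>s. t / 2 * (1 / a s) + 1 / (2 * t) * E s) has_integral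
        (t / 2 * A + 1 / (2 * t) * integral {x..y} E)) {x..y}"
      using W E_xy by (intro has_integral_add has_integral_mult_right) auto
    have le: "\<bar>deriv u s\<bar> \<le> t / 2 * (1 / a s) + 1 / (2 * t) * E s" if s: "s \<in> {x..y}" for s
    proof -
      have "E s = a s * \<bar>deriv u s\<bar>\<^sup>2"
        using a[OF s] by (simp add: E_def abs_mult power_mult_distrib powr_numeral)
      \<comment> \<open>Expanding this square and dividing by \<open>2 * t * a s\<close> is Young's
        inequality.\<close>
      moreover have "0 \<le> (t - a s * \<bar>deriv u s\<bar>)\<^sup>2" by simp
      ultimately show ?thesis
        using a[OF s] \<open>t > 0\<close> by (simp add: field_simps power2_eq_square)
    qed
    have "u y - u x \<le> t / 2 * A + 1 / (2 * t) * integral {x..y} E"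
      using D R by (rule has_integral_le) (use le in fastforce)
    moreover have "- (u y - u x) \<le> t / 2 * A + 1 / (2 * t) * integral {x..y} E"
      using has_integral_neg[OF D] R by (rule has_integral_le) (use le in fastforce)
    moreover have "1 / (2 * t) * integral {x..y} E \<le> K / (2 * t)"
      using E_le \<open>t > 0\<close> by (simp add: divide_right_mono)
    ultimately show ?thesis by linarith
  qed
  from weighted_Cauchy_Schwarz[OF \<open>A \<ge> 0\<close> \<open>K \<ge> 0\<close> _ this] show ?thesis
    by (simp add: A_def K_def E_def)
qed


section \<open>Elementary facts on powers and Lebesgue spaces\<close>

lemma powr_add_le:
  fixes A B p :: real
  assumes "A \<ge> 0" "B \<ge> 0" "p \<ge> 0"
  shows "(A + B) powr p \<le> (2 * A) powr p + (2 * B) powr p"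
proof (cases "A \<le> B")
  case True
  then have "(A + B) powr p \<le> (2 * B) powr p" using assms by (intro powr_mono2) auto
  then show ?thesis by (simp add: add_increasing)
next
  case False
  then have "(A + B) powr p \<le> (2 * A) powr p" using assms by (intro powr_mono2) auto
  then show ?thesis by (simp add: add_increasing2)
qed

lemma Lp_norm_2_squared: "(Lp_norm 2 S f)\<^sup>2 = (\<integral>x. \<bar>f x\<bar> powr 2 \<partial>lebesgue_on S)"
proof -
  have "0 \<le> (\<integral>x. \<bar>f x\<bar> powr 2 \<partial>lebesgue_on S)" by (intro integral_nonneg_AE) auto
  then show ?thesis
    by (simp add: Lp_norm_def powr_half_sqrt)
qed

text \<open>On a set of finite measure \<open>1 + \<bar>f x\<bar> powr p\<close> is an integrable
  majorant. This supplies the integrability of \<open>\<xi>\<close> that controls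
  \<open>u 0\<close>.\<close>

lemma Lp_space_imp_integrable_abs:
  assumes "f \<in> Lp_space p S" "p \<ge> 1" "S \<in> lmeasurable"
  shows "integrable (lebesgue_on S) (\<lambda>x. \<bar>f x\<bar>)"
proof (rule Bochner_Integration.integrable_bound)
  have "integrable (lebesgue_on S) (\<lambda>x. 1 :: real)"
    using finite_measure_lebesgue_on[OF assms(3)] by (rule finite_measure.integrable_const)
  then show "integrable (lebesgue_on S) (\<lambda>x. 1 + \<bar>f x\<bar> powr p)"
    using assms(1) by (intro Bochner_Integration.integrable_add) (auto simp: Lp_space_def)
  have [measurable]: "f \<in> borel_measurable (lebesgue_on S)" using assms(1) by (simp add: Lp_space_def)
  show "(\<lambda>x. \<bar>f x\<bar>) \<in> borel_measurable (lebesgue_on S)" by measurable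
  have "\<bar>f x\<bar> \<le> 1 + \<bar>f x\<bar> powr p" for x
  proof (cases "\<bar>f x\<bar> \<le> 1")
    case True
    then show ?thesis by (simp add: add_increasing2)
  next
    case False
    then have "\<bar>f x\<bar> powr 1 \<le> \<bar>f x\<bar> powr p" using assms(2) by (intro powr_mono) auto
    then show ?thesis by simp
  qed
  then show "AE x in lebesgue_on S. norm \<bar>f x\<bar> \<le> norm (1 + \<bar>f x\<bar> powr p)"
    by (intro AE_I2) (simp add: add_nonneg_nonneg)
qed

theorem lemma3p2:
  fixes a :: "real \<Rightarrow> real" and p :: real
  assumes "C1_on {-1..1} a"
    and "\<And>x. x \<in> {-1<..<1} \<Longrightarrow> a x > 0"
    and "a (-1) = 0" and "a 1 = 0"
    and "p \<ge> 1"
    and "\<xi> a \<in> Lp_space p {-1<..<1}"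
  shows "H1a a \<subseteq> Lp_space (2 * p) {-1<..<1} \<and>
         (\<exists>c>0. \<forall>u\<in>H1a a. Lp_norm (2 * p) {-1<..<1} u \<le> c * H1a_norm a u)"
proof -
  let ?M = "lebesgue_on {-1<..<1::real}"
  note pos = assms(2) and p = assms(5)
  have cont: "continuous_on {-1<..<1} a"
    by (rule continuous_on_subset[OF C1_on_imp_continuous_on[OF assms(1)]]) auto
  have lm: "{-1<..<1::real} \<in> lmeasurable" by simp
  define L where "L = (\<integral>x. \<bar>\<xi> a x\<bar> \<partial>?M)"
  define I where "I = (\<integral>x. \<bar>\<xi> a x\<bar> powr p \<partial>?M)"
  have L_int: "integrable ?M (\<lambda>x. \<bar>\<xi> a x\<bar>)"
    using Lp_space_imp_integrable_abs[OF assms(6) p lm] .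
  have I_int: "integrable ?M (\<lambda>x. \<bar>\<xi> a x\<bar> powr p)"
    using assms(6) by (simp add: Lp_space_def)
  have "L \<ge> 0" "I \<ge> 0" unfolding L_def I_def by (auto intro: integral_nonneg_AE)
  \<comment> \<open>Chosen so that the integral of \<open>\<bar>u x\<bar> powr (2 * p)\<close> is at
    most \<open>C * S powr p\<close>, with \<open>S\<close> the squared weighted norm. The leading 2
    is the length of the interval, and \<open>1 + L\<close> makes \<open>C\<close> positive.\<close>
  define C where "C = 2 * (4 * (1 + L)) powr p + 4 powr p * I"
  have "C > 0" using \<open>L \<ge> 0\<close> \<open>I \<ge> 0\<close> by (simp add: C_def add_pos_nonneg)
  have const: "integrable ?M (\<lambda>x. k)" for k :: real
    using finite_measure_lebesgue_on[OF lm] by (rule finite_measure.integrable_const)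
  have M: "measure ?M {-1<..<1} = 2"
    by (simp add: measure_restrict_space)
  have main: "u \<in> Lp_space (2 * p) {-1<..<1} \<and>
      Lp_norm (2 * p) {-1<..<1} u \<le> C powr (1 / (2 * p)) * H1a_norm a u" if u: "u \<in> H1a a" for u
  proof -
    define K where "K = (\<integral>s. \<bar>sqrt (a s) * deriv u s\<bar> powr 2 \<partial>?M)"
    define N where "N = (\<integral>x. \<bar>u x\<bar> powr 2 \<partial>?M)"
    define S where "S = N + K"
    have "K \<ge> 0" "N \<ge> 0" unfolding K_def N_def by (auto intro: integral_nonneg_AE)
    then have S: "S \<ge> 0" "K \<le> S" "N \<le> S" by (auto simp: S_def)
    have norm: "H1a_norm a u = sqrt S"
      by (simp add: H1a_norm_def Lp_norm_2_squared S_def K_def N_def)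
    have u_meas [measurable]: "u \<in> borel_measurable ?M" and N_int: "integrable ?M (\<lambda>x. \<bar>u x\<bar> powr 2)"
      using u by (auto simp: H1a_def Lp_space_def)
    \<comment> \<open>The increment bound is applied on \<open>[0, x]\<close> or
      \<open>[x, 0]\<close>; in both cases \<open>\<xi> a 0 = 0\<close> leaves a single value of
      \<open>\<xi>\<close>.\<close>
    have inc: "(u x - u 0)\<^sup>2 \<le> K * \<bar>\<xi> a x\<bar>" if x: "x \<in> {-1<..<1}" for x
    proof (cases "0 \<le> x")
      case True
      with x have "(u x - u 0)\<^sup>2 \<le> K * \<xi> a x"
        using H1a_increment_le[OF cont pos u, of 0 x] by (simp add: K_def)
      also have "\<dots> \<le> K * \<bar>\<xi> a x\<bar>" using \<open>K \<ge> 0\<close> by (intro mult_left_mono) auto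
      finally show ?thesis .
    next
      case False
      with x have "(u 0 - u x)\<^sup>2 \<le> K * (- \<xi> a x)"
        using H1a_increment_le[OF cont pos u, of x 0] by (simp add: K_def)
      also have "\<dots> \<le> K * \<bar>\<xi> a x\<bar>" using \<open>K \<ge> 0\<close> by (intro mult_left_mono) auto
      finally show ?thesis by (simp add: power2_commute)
    qed
    \<comment> \<open>The right side minus the left side is exactly the square of
      \<open>s - 2 * t\<close>.\<close>
    have split: "s\<^sup>2 \<le> 2 * t\<^sup>2 + 2 * (s - t)\<^sup>2" for s t :: real
      using zero_le_power2[of "s - 2 * t"] by (simp add: power2_eq_square algebra_simps)
    have u0: "(u 0)\<^sup>2 \<le> S * (1 + L)"
    proof -
      \<comment> \<open>The constant is integrated over an interval of length 2, which turns a bound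
        at each \<open>x\<close> into one by \<open>N\<close> and \<open>L\<close>.\<close>
      have "2 * (u 0)\<^sup>2 = (\<integral>x. (u 0)\<^sup>2 \<partial>?M)" by (simp add: M)
      also have "\<dots> \<le> (\<integral>x. 2 * \<bar>u x\<bar> powr 2 + 2 * (K * \<bar>\<xi> a x\<bar>) \<partial>?M)"
      proof (intro integral_mono)
        fix x assume "x \<in> space ?M"
        then have "x \<in> {-1<..<1}" by simp
        from inc[OF this] split[of "u 0" "u x"]
        show "(u 0)\<^sup>2 \<le> 2 * \<bar>u x\<bar> powr 2 + 2 * (K * \<bar>\<xi> a x\<bar>)"
          by (simp add: powr_numeral power2_commute[of "u 0" "u x"])
      qed (use const N_int L_int in auto)
      also have "\<dots> = 2 * N + 2 * (K * L)"
        using N_int L_int by (simp add: N_def L_def)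
      finally have "(u 0)\<^sup>2 \<le> N + K * L" by simp
      also have "\<dots> \<le> S + S * L" using S \<open>L \<ge> 0\<close> by (intro add_mono mult_right_mono)
      finally show ?thesis by (simp add: algebra_simps)
    qed
    \<comment> \<open>Each 4 is a factor 2 from \<open>split\<close> times a factor 2 from
      \<open>powr_add_le\<close>.\<close>
    let ?R = "\<lambda>x. (4 * (S * (1 + L))) powr p + (4 * S) powr p * \<bar>\<xi> a x\<bar> powr p"
    have R_int: "integrable ?M ?R" using const I_int by (intro Bochner_Integration.integrable_add) auto
    have bound: "\<bar>u x\<bar> powr (2 * p) \<le> ?R x" if x: "x \<in> {-1<..<1}" for x
    proof -
      have "(u x)\<^sup>2 \<le> 2 * (u 0)\<^sup>2 + 2 * (K * \<bar>\<xi> a x\<bar>)"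
        using split[of "u x" "u 0"] inc[OF x] by simp
      also have "\<dots> \<le> 2 * (S * (1 + L)) + 2 * (S * \<bar>\<xi> a x\<bar>)"
        using u0 S by (intro add_mono mult_left_mono mult_right_mono) auto
      finally have le: "(u x)\<^sup>2 \<le> 2 * (S * (1 + L)) + 2 * (S * \<bar>\<xi> a x\<bar>)" .
      have "\<bar>u x\<bar> powr (2 * p) = ((u x)\<^sup>2) powr p"
        by (simp add: powr_powr[symmetric] powr_numeral)
      also have "\<dots> \<le> (2 * (S * (1 + L)) + 2 * (S * \<bar>\<xi> a x\<bar>)) powr p"
        using le p by (intro powr_mono2) auto
      also have "\<dots> \<le> (2 * (2 * (S * (1 + L)))) powr p + (2 * (2 * (S * \<bar>\<xi> a x\<bar>))) powr p"
        using S \<open>L \<ge> 0\<close> p by (intro powr_add_le) auto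
      also have "(2 * (2 * (S * \<bar>\<xi> a x\<bar>))) powr p = (4 * S) powr p * \<bar>\<xi> a x\<bar> powr p"
        using S by (simp add: powr_mult[symmetric] mult.assoc)
      finally show ?thesis by simp
    qed
    have int: "integrable ?M (\<lambda>x. \<bar>u x\<bar> powr (2 * p))"
    proof (rule Bochner_Integration.integrable_bound[OF R_int])
      show "(\<lambda>x. \<bar>u x\<bar> powr (2 * p)) \<in> borel_measurable ?M" by measurable
      show "AE x in ?M. norm (\<bar>u x\<bar> powr (2 * p)) \<le> norm (?R x)"
        using bound by (intro AE_I2) (simp add: abs_of_nonneg add_nonneg_nonneg)
    qed
    then have mem: "u \<in> Lp_space (2 * p) {-1<..<1}"
      using u_meas by (simp add: Lp_space_def)
    have "(\<integral>x. \<bar>u x\<bar> powr (2 * p) \<partial>?M) \<le> (\<integral>x. ?R x \<partial>?M)"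
      using int R_int bound by (intro integral_mono) auto
    also have "\<dots> = 2 * (4 * (S * (1 + L))) powr p + (4 * S) powr p * I"
      using const I_int by (simp add: I_def M)
    also have "(4 * (S * (1 + L))) powr p = S powr p * (4 * (1 + L)) powr p"
      using S \<open>L \<ge> 0\<close> by (subst powr_mult[symmetric]) (simp_all add: mult_ac)
    also have "(4 * S) powr p = S powr p * 4 powr p"
      using S by (subst powr_mult[symmetric]) (simp_all add: mult_ac)
    \<comment> \<open>Every term scales like \<open>S powr p\<close>, so the exponent
      \<open>1 / (2 * p)\<close> leaves the square root of \<open>S\<close>, which is the weighted
      norm.\<close>
    also have "2 * (S powr p * (4 * (1 + L)) powr p) + S powr p * 4 powr p * I = C * S powr p"
      by (simp add: C_def algebra_simps)
    finally have "Lp_norm (2 * p) {-1<..<1} u \<le> (C * S powr p) powr (1 / (2 * p))"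
      unfolding Lp_norm_def using p by (intro powr_mono2) (auto intro: integral_nonneg_AE)
    also have "\<dots> = C powr (1 / (2 * p)) * S powr (1 / 2)"
      using \<open>C > 0\<close> S p by (simp add: powr_mult powr_powr)
    also have "\<dots> = C powr (1 / (2 * p)) * H1a_norm a u"
      using S by (simp add: norm powr_half_sqrt)
    finally show ?thesis using mem by blast
  qed
  moreover have "C powr (1 / (2 * p)) > 0" using \<open>C > 0\<close> by simp
  ultimately show ?thesis by blast
qed

end
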